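(* Let $P$ be the diagonalizable transition matrix of an absorbing Markov chain restricted to its finite set $\mathcal{T}$ of transient states, with biorthogonal eigenvectors $\varphi_\nu,\psi_\nu$ and spectral coefficients $A_\nu,B_\nu$ as in the context. Let $\sigma:\mathcal{T}\to\mathcal{T}$ be an involution and $\kappa:\mathcal{T}\to(0,\infty)$ a weight (independent of $\nu$) such that $B_\nu(z)=\kappa(z)A_\nu(\sigma(z))$ for all $\nu$ and all $z\in\mathcal{T}$, and $\kappa(z)\kappa(\sigma(z))=K$ is independent of $z$. Assume every mode is active: $\psi_\nu^{\mathsf T}b^{(0)}\neq0$ for all $\nu$. Then, for every $\gamma\in(0,1)$, $$\mathcal{R}\,R(\gamma)\,\mathcal{R}=\Delta^{-2}\,R(\gamma)\,\Delta^{2}.$$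
   Context: Setting. A Markov chain lives on a finite set $\mathcal{T}\cup\partial_0\cup\partial_1$ (disjoint union); $\mathcal{T}$ consists of transient states, $\partial_0\cup\partial_1$ is the absorbing boundary, the restriction of the chain to $\mathcal{T}$ is irreducible, and absorption is certain from every state of $\mathcal{T}$. $P=(P_{z,w})_{z,w\in\mathcal{T}}$ is the restricted transition matrix (spectral radius $<1$), and $R(\gamma)=(I-(1-\gamma)P)^{-1}$ for $\gamma\in(0,1)$. The boundary fluxes are $b^{(0)}_x=\sum_{y\in\partial_0}P_{xy}$, $b^{(1)}_x=\sum_{y\in\partial_1}P_{xy}$. $P$ is diagonalizable with eigenvalues $\lambda_\nu$ and biorthogonal right/left eigenvectors $\varphi_\nu,\psi_\nu$ ($\nu=1,\dots,|\mathcal{T}|$): $P\varphi_\nu=\lambda_\nu\varphi_\nu$, $\psi_\nu^{\mathsf T}P=\lambda_\nu\psi_\nu^{\mathsf T}$, $\psi_\nu^{\mathsf T}\varphi_\mu=\delta_{\nu\mu}$. The spectral coefficients are $A_\nu(z)=\varphi_\nu(z)(\psi_\nu^{\mathsf T}b^{(0)})$, $B_\nu(z)=\varphi_\nu(z)(\psi_\nu^{\mathsf T}b^{(1)})$. Operators on functions $f:\mathcal{T}\to\mathbb{C}$: $(\mathcal{R}f)(z)=f(\sigma(z))$ and $\Delta=\operatorname{diag}(\sqrt{\kappa(z)})$. *)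

theory Defs
  imports "HOL-Probability.Probability"
begin

text \<open>
  The states are \<open>'t + 'b\<close>: \<open>Inl\<close> marks the transient states, \<open>Inr\<close> the absorbing boundary, and
  \<open>N s\<close> is the distribution of the successor of the state \<open>s\<close>.
\<close>

text \<open>The law of \<open>X\<^sub>i\<close> given \<open>X\<^sub>0, \<dots>, X\<^sub>i\<^sub>-\<^sub>1\<close>, for the chain started at \<open>s\<close>.\<close>

definition step_kernel :: "('s \<Rightarrow> 's pmf) \<Rightarrow> 's \<Rightarrow> nat \<Rightarrow> (nat \<Rightarrow> 's) \<Rightarrow> 's measure" where
  "step_kernel N s i \<omega> = measure_pmf (if i = 0 then return_pmf s else N (\<omega> (i - 1)))"

lemma Ionescu_Tulcea_step_kernel:
  fixes N :: "'s::finite \<Rightarrow> 's pmf"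
  shows "Ionescu_Tulcea (step_kernel N s) (\<lambda>_. count_space UNIV)"
proof (rule Ionescu_Tulcea.intro)
  fix i :: nat
  have "step_kernel N s i \<omega> \<in> space (subprob_algebra (count_space UNIV))" for \<omega>
    by (simp add: step_kernel_def measure_pmf_in_subprob_algebra)
  moreover have "PiM {0..<i} (\<lambda>_. count_space (UNIV :: 's set)) = count_space (PiE {0..<i} (\<lambda>_. UNIV))"
    by (rule count_space_PiM_finite) auto
  ultimately show "step_kernel N s i \<in> measurable (PiM {0..<i} (\<lambda>_. count_space UNIV))
      (subprob_algebra (count_space UNIV))"
    by simp
next
  fix i :: nat and \<omega> :: "nat \<Rightarrow> 's"
  show "prob_space (step_kernel N s i \<omega>)"
    by (simp add: step_kernel_def prob_space_measure_pmf)
qed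

text \<open>The law of the whole trajectory of the chain started at \<open>s\<close> (Ionescu-Tulcea theorem).\<close>

definition path_measure :: "('s::finite \<Rightarrow> 's pmf) \<Rightarrow> 's \<Rightarrow> (nat \<Rightarrow> 's) measure" where
  "path_measure N s =
     projective_family.lim UNIV
       (Ionescu_Tulcea.CI (step_kernel N s) (\<lambda>_. count_space UNIV)) (\<lambda>_. count_space UNIV)"

locale absorbing_chain =
  fixes N :: "'t::finite + 'b::finite \<Rightarrow> ('t + 'b) pmf"
    and D0 D1 :: "'b set"
  assumes boundary_disjoint: "D0 \<inter> D1 = {}"
    and boundary_cover: "D0 \<union> D1 = UNIV"
    and absorbing: "N (Inr y) = return_pmf (Inr y)"
    and irreducible: "(x, z) \<in> {(u, v). pmf (N (Inl u)) (Inl v) > 0}\<^sup>*"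
    and absorption_certain: "AE \<omega> in path_measure N (Inl z). \<exists>n. \<omega> n \<in> range Inr"

text \<open>
  The matrices are complex because the eigenvalues and eigenvectors are.
\<close>

definition transient_matrix :: "('t::finite + 'b::finite \<Rightarrow> ('t + 'b) pmf) \<Rightarrow> complex^'t^'t" where
  "transient_matrix N = (\<chi> z w. complex_of_real (pmf (N (Inl z)) (Inl w)))"

definition flux :: "('t::finite + 'b::finite \<Rightarrow> ('t + 'b) pmf) \<Rightarrow> 'b set \<Rightarrow> complex^'t" where
  "flux N D = (\<chi> x. \<Sum>y\<in>D. complex_of_real (pmf (N (Inl x)) (Inr y)))"

definition resolvent :: "complex^'t^'t \<Rightarrow> real \<Rightarrow> complex^'t^'t" where
  "resolvent P \<gamma> = matrix_inv (mat 1 - (1 - \<gamma>) *\<^sub>R P)"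

text \<open>Note that \<^const>\<open>scalar_product\<close> is bilinear, without complex conjugation.\<close>

definition biorthogonal_eigensystem ::
    "complex^'t^'t \<Rightarrow> (nat \<Rightarrow> complex) \<Rightarrow> (nat \<Rightarrow> complex^'t) \<Rightarrow> (nat \<Rightarrow> complex^'t) \<Rightarrow> bool" where
  "biorthogonal_eigensystem P lam \<phi> \<psi> \<longleftrightarrow>
     (\<forall>\<nu>\<in>{1..CARD('t)}. P *v \<phi> \<nu> = lam \<nu> *s \<phi> \<nu> \<and> \<psi> \<nu> v* P = lam \<nu> *s \<psi> \<nu>) \<and>
     (\<forall>\<nu>\<in>{1..CARD('t)}. \<forall>\<mu>\<in>{1..CARD('t)}.
        scalar_product (\<psi> \<nu>) (\<phi> \<mu>) = (if \<nu> = \<mu> then 1 else 0))"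

text \<open>\<open>A\<^sub>\<nu>(z)\<close> for \<open>b = b\<^sup>(\<^sup>0\<^sup>)\<close> and \<open>B\<^sub>\<nu>(z)\<close> for \<open>b = b\<^sup>(\<^sup>1\<^sup>)\<close>.\<close>

definition spectral_coeff ::
    "(nat \<Rightarrow> complex^'t) \<Rightarrow> (nat \<Rightarrow> complex^'t) \<Rightarrow> complex^'t \<Rightarrow> nat \<Rightarrow> 't \<Rightarrow> complex" where
  "spectral_coeff \<phi> \<psi> b \<nu> z = \<phi> \<nu> $ z * scalar_product (\<psi> \<nu>) b"

definition reflection :: "('t \<Rightarrow> 't) \<Rightarrow> complex^'t^'t" where
  "reflection \<sigma> = matrix (\<lambda>f. \<chi> z. f $ \<sigma> z)"

definition weight_matrix :: "('t \<Rightarrow> real) \<Rightarrow> complex^'t^'t" where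
  "weight_matrix \<kappa> = (\<chi> z w. if z = w then complex_of_real (sqrt (\<kappa> z)) else 0)"

lemma reflection_apply:
  fixes f :: "complex^'t"
  shows "(reflection \<sigma> *v f) $ z = f $ \<sigma> z"
  by (simp add: reflection_def matrix_def matrix_vector_mult_def axis_def if_distribR
      if_distrib[of "\<lambda>c. c * _"] cong: if_cong)

end

theory Submission
  imports Defs
begin

text \<open>
  Write \<open>R\<close> for the reflection, \<open>D = \<Delta>\<^sup>2\<close> for the diagonal matrix of the weight and \<open>P\<close> for
  the transient matrix. For an active mode, the hypothesis \<open>B\<^sub>\<nu>(z) = \<kappa>(z) A\<^sub>\<nu>(\<sigma>(z))\<close> can be divided by
  \<open>\<psi>\<^sub>\<nu>\<^sup>T b\<^sup>(\<^sup>0\<^sup>)\<close>, and it then says that \<open>\<phi>\<^sub>\<nu>\<close> is an eigenvector of \<open>D R\<close>, with eigenvalue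
  \<open>\<psi>\<^sub>\<nu>\<^sup>T b\<^sup>(\<^sup>1\<^sup>) / \<psi>\<^sub>\<nu>\<^sup>T b\<^sup>(\<^sup>0\<^sup>)\<close>. So \<open>D R\<close> and \<open>P\<close> are diagonal in the same basis and commute
  (\<open>commute_if_common_eigensystem\<close>), whence \<open>D R\<close> also commutes with the resolvent. Cancelling \<open>D\<close>
  on the left and using \<open>R\<^sup>2 = 1\<close> turns this commutation relation into the claim.

  The matrix \<open>1 - (1 - \<gamma>) P\<close> must really be invertible for its inverse to be meaningful. The rows of
  \<open>P\<close> are nonnegative with sum at most \<open>1\<close>, so \<open>(1 - \<gamma>) P\<close> is a strict contraction in the
  maximum norm and fixes only the zero vector (\<open>invertible_id_minus_transient\<close>).
\<close>

section \<open>Commuting matrices\<close>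

lemma matrix_inv_left_right:
  fixes A :: "'a::field^'n^'n"
  assumes "invertible A"
  shows matrix_inv_left: "matrix_inv A ** A = mat 1"
    and matrix_inv_right: "A ** matrix_inv A = mat 1"
proof -
  have "A ** matrix_inv A = mat 1 \<and> matrix_inv A ** A = mat 1"
    unfolding matrix_inv_def by (rule someI_ex) (use assms in \<open>simp add: invertible_def\<close>)
  then show "matrix_inv A ** A = mat 1" and "A ** matrix_inv A = mat 1"
    by simp_all
qed

lemma matrix_inv_commute:
  fixes A M :: "'a::field^'n^'n"
  assumes "invertible A" and "M ** A = A ** M"
  shows "M ** matrix_inv A = matrix_inv A ** M"
proof -
  have "M ** matrix_inv A = matrix_inv A ** (A ** M) ** matrix_inv A"
    by (simp add: matrix_mul_assoc matrix_inv_left[OF assms(1)])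
  also have "\<dots> = matrix_inv A ** M ** (A ** matrix_inv A)"
    by (simp add: assms(2)[symmetric] matrix_mul_assoc)
  finally show ?thesis
    by (simp add: matrix_inv_right[OF assms(1)])
qed

lemma commute_id_minus:
  fixes P M :: "complex^'n^'n"
  assumes "M ** P = P ** M"
  shows "M ** (mat 1 - c *\<^sub>R P) = (mat 1 - c *\<^sub>R P) ** M"
proof -
  have left: "M ** (c *\<^sub>R P) = c *\<^sub>R (M ** P)"
    and right: "(c *\<^sub>R P) ** M = c *\<^sub>R (P ** M)"
    by (simp_all add: matrix_matrix_mult_def vec_eq_iff scaleR_sum_right)
  have "M ** (mat 1 - c *\<^sub>R P) = M - M ** (c *\<^sub>R P)"
    by (simp add: matrix_eq matrix_vector_mult_diff_rdistrib matrix_vector_mult_diff_distrib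
        flip: matrix_vector_mul_assoc)
  also have "\<dots> = M - (c *\<^sub>R P) ** M"
    by (simp add: left right assms)
  also have "\<dots> = (mat 1 - c *\<^sub>R P) ** M"
    by (simp add: matrix_eq matrix_vector_mult_diff_rdistrib flip: matrix_vector_mul_assoc)
  finally show ?thesis .
qed

text \<open>
  Biorthogonality says that the matrix with rows \<open>\<psi>\<^sub>\<nu>\<close> is a left inverse of the square matrix \<open>\<Phi>\<close>
  with columns \<open>\<phi>\<^sub>\<nu>\<close>. A one-sided inverse of a square matrix is two-sided, so the values on the
  \<open>\<phi>\<^sub>\<nu>\<close> determine a matrix.
\<close>

lemma matrix_eq_on_biorthogonal:
  fixes X Y :: "complex^'t^'t"
  assumes bi: "\<And>\<nu> \<mu>. \<nu> \<in> {1..CARD('t)} \<Longrightarrow> \<mu> \<in> {1..CARD('t)} \<Longrightarrow>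
        scalar_product (\<psi> \<nu>) (\<phi> \<mu>) = (if \<nu> = \<mu> then 1 else 0)"
    and eq: "\<And>\<nu>. \<nu> \<in> {1..CARD('t)} \<Longrightarrow> X *v \<phi> \<nu> = Y *v \<phi> \<nu>"
  shows "X = Y"
proof -
  obtain g :: "'t \<Rightarrow> nat" where g: "bij_betw g UNIV {1..CARD('t)}"
    using finite_same_card_bij[of "UNIV :: 't set" "{1..CARD('t)}"] by auto
  have g_in: "g w \<in> {1..CARD('t)}" for w
    using bij_betwE[OF g] by blast
  have g_eq: "g v = g w \<longleftrightarrow> v = w" for v w
    using bij_betw_imp_inj_on[OF g] by (auto dest: injD)
  define \<Phi> :: "complex^'t^'t" where "\<Phi> = (\<chi> z w. \<phi> (g w) $ z)"
  define \<Psi> :: "complex^'t^'t" where "\<Psi> = (\<chi> w z. \<psi> (g w) $ z)"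
  have "(\<Psi> ** \<Phi>) $ v $ w = mat 1 $ v $ w" for v w
    using bi[OF g_in g_in, of v w]
    by (simp add: \<Phi>_def \<Psi>_def matrix_matrix_mult_def mat_def scalar_product_def g_eq)
  then have "\<Psi> ** \<Phi> = mat 1"
    by (simp add: vec_eq_iff)
  then have inv: "\<Phi> ** \<Psi> = mat 1"
    by (simp add: matrix_left_right_inverse)
  have "(Z ** \<Phi>) $ z $ w = (Z *v \<phi> (g w)) $ z" for Z :: "complex^'t^'t" and z w
    by (simp add: \<Phi>_def matrix_matrix_mult_def matrix_vector_mult_def)
  then have "X ** \<Phi> = Y ** \<Phi>"
    by (simp add: vec_eq_iff eq[OF g_in])
  then have "X ** (\<Phi> ** \<Psi>) = Y ** (\<Phi> ** \<Psi>)"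
    by (simp add: matrix_mul_assoc)
  then show ?thesis
    by (simp add: inv)
qed

lemma commute_if_common_eigensystem:
  fixes P M :: "complex^'t^'t"
  assumes bio: "biorthogonal_eigensystem P lam \<phi> \<psi>"
    and M: "\<And>\<nu>. \<nu> \<in> {1..CARD('t)} \<Longrightarrow> M *v \<phi> \<nu> = r \<nu> *s \<phi> \<nu>"
  shows "M ** P = P ** M"
proof (rule matrix_eq_on_biorthogonal[of \<psi> \<phi>])
  show "scalar_product (\<psi> \<nu>) (\<phi> \<mu>) = (if \<nu> = \<mu> then 1 else 0)"
    if "\<nu> \<in> {1..CARD('t)}" "\<mu> \<in> {1..CARD('t)}" for \<nu> \<mu>
    using bio that unfolding biorthogonal_eigensystem_def by blast
next
  fix \<nu> assume \<nu>: "\<nu> \<in> {1..CARD('t)}"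
  then have P: "P *v \<phi> \<nu> = lam \<nu> *s \<phi> \<nu>"
    using bio unfolding biorthogonal_eigensystem_def by blast
  show "(M ** P) *v \<phi> \<nu> = (P ** M) *v \<phi> \<nu>"
    by (simp add: P M[OF \<nu>] vec.scale mult.commute flip: matrix_vector_mul_assoc)
qed

section \<open>The resolvent of the transient matrix\<close>

lemma transient_row_sum_le_1:
  fixes N :: "'t::finite + 'b::finite \<Rightarrow> ('t + 'b) pmf"
  shows "(\<Sum>w\<in>UNIV. pmf (N (Inl z)) (Inl w)) \<le> 1"
proof -
  have "(\<Sum>w\<in>UNIV. pmf (N (Inl z)) (Inl w)) = sum (pmf (N (Inl z))) (range Inl)"
    by (simp add: sum.reindex)
  also have "\<dots> = measure_pmf.prob (N (Inl z)) (range Inl)"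
    by (simp add: measure_measure_pmf_finite)
  finally show ?thesis
    by simp
qed

text \<open>
  Evaluate a fixed vector of \<open>(1 - \<gamma>) P\<close> at a state where its modulus \<open>m\<close> is largest:
  \<open>m \<le> (1 - \<gamma>) m\<close>, so \<open>m = 0\<close>.
\<close>

lemma invertible_id_minus_transient:
  fixes N :: "'t::finite + 'b::finite \<Rightarrow> ('t + 'b) pmf"
  assumes \<gamma>: "\<gamma> \<in> {0<..<1}"
  shows "invertible (mat 1 - (1 - \<gamma>) *\<^sub>R transient_matrix N)"
proof -
  have "v = 0" if v0: "(mat 1 - (1 - \<gamma>) *\<^sub>R transient_matrix N) *v v = 0" for v :: "complex^'t"
  proof -
    have v: "v $ z = (1 - \<gamma>) *\<^sub>R (\<Sum>w\<in>UNIV. complex_of_real (pmf (N (Inl z)) (Inl w)) * v $ w)" for z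
    proof -
      have "v - ((1 - \<gamma>) *\<^sub>R transient_matrix N) *v v = 0"
        using v0 by (simp add: matrix_vector_mult_diff_rdistrib)
      then have "v $ z = (((1 - \<gamma>) *\<^sub>R transient_matrix N) *v v) $ z"
        by simp
      then show ?thesis
        by (simp add: matrix_vector_mult_def transient_matrix_def scaleR_sum_right)
    qed
    define m where "m = Max (range (\<lambda>w. norm (v $ w)))"
    have le: "norm (v $ w) \<le> m" for w
      unfolding m_def by (rule Max_ge) auto
    have "m \<in> range (\<lambda>w. norm (v $ w))"
      unfolding m_def by (rule Max_in) auto
    then obtain z where z: "m = norm (v $ z)"
      by auto
    have "m = (1 - \<gamma>) * norm (\<Sum>w\<in>UNIV. complex_of_real (pmf (N (Inl z)) (Inl w)) * v $ w)"
      using \<gamma> by (subst z, subst v) simp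
    also have "\<dots> \<le> (1 - \<gamma>) * (\<Sum>w\<in>UNIV. pmf (N (Inl z)) (Inl w) * m)"
      using \<gamma> by (intro mult_left_mono sum_norm_le) (auto simp: norm_mult le mult_left_mono)
    also have "\<dots> = (1 - \<gamma>) * ((\<Sum>w\<in>UNIV. pmf (N (Inl z)) (Inl w)) * m)"
      by (simp add: sum_distrib_right)
    also have "\<dots> \<le> (1 - \<gamma>) * (1 * m)"
      using \<gamma> z by (intro mult_left_mono mult_right_mono transient_row_sum_le_1) auto
    finally have "\<gamma> * m \<le> 0"
      by (simp add: algebra_simps)
    then have "m \<le> 0"
      using \<gamma> by (simp add: mult_le_0_iff)
    then show "v = 0"
      using le by (simp add: vec_eq_iff) (meson norm_le_zero_iff order_trans)
  qed
  then show ?thesis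
    by (simp add: invertible_left_inverse matrix_left_invertible_ker)
qed

section \<open>Reflection and weight\<close>

lemma reflection_involution:
  fixes \<sigma> :: "'t::finite \<Rightarrow> 't"
  assumes "\<And>z. \<sigma> (\<sigma> z) = z"
  shows "reflection \<sigma> ** reflection \<sigma> = mat 1"
  by (simp add: matrix_eq vec_eq_iff reflection_apply assms flip: matrix_vector_mul_assoc)

lemma weight_matrix_apply:
  "(weight_matrix \<kappa> *v f) $ z = complex_of_real (sqrt (\<kappa> z)) * f $ z"
  by (simp add: weight_matrix_def matrix_vector_mult_def if_distribR
      if_distrib[of "\<lambda>c. c * _"] cong: if_cong)

lemma weight_matrix_squared_apply:
  assumes "\<kappa> z > 0"
  shows "((weight_matrix \<kappa> ** weight_matrix \<kappa>) *v f) $ z = complex_of_real (\<kappa> z) * f $ z"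
proof -
  have "complex_of_real (sqrt (\<kappa> z)) * complex_of_real (sqrt (\<kappa> z)) = complex_of_real (\<kappa> z)"
    using assms by (simp flip: of_real_mult)
  then show ?thesis
    by (simp add: weight_matrix_apply flip: matrix_vector_mul_assoc mult.assoc)
qed

lemma invertible_weight_matrix_squared:
  fixes \<kappa> :: "'t::finite \<Rightarrow> real"
  assumes pos: "\<And>z. \<kappa> z > 0"
  shows "invertible (weight_matrix \<kappa> ** weight_matrix \<kappa>)"
proof -
  have "v = 0" if "(weight_matrix \<kappa> ** weight_matrix \<kappa>) *v v = 0" for v :: "complex^'t"
  proof -
    have "complex_of_real (\<kappa> z) * v $ z = 0" for z
      using that by (simp add: pos flip: weight_matrix_squared_apply)
    then show ?thesis
      using pos by (simp add: vec_eq_iff) (metis less_irrefl)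
  qed
  then show ?thesis
    by (simp add: invertible_left_inverse matrix_left_invertible_ker)
qed

section \<open>The reflected resolvent\<close>

theorem mainTheorem2:
  fixes N :: "'t::finite + 'b::finite \<Rightarrow> ('t + 'b) pmf"
    and D0 D1 :: "'b set"
    and lam :: "nat \<Rightarrow> complex"
    and \<phi> \<psi> :: "nat \<Rightarrow> complex^'t"
    and \<sigma> :: "'t \<Rightarrow> 't"
    and \<kappa> :: "'t \<Rightarrow> real"
    and K \<gamma> :: real
  assumes "absorbing_chain N D0 D1"
    and "biorthogonal_eigensystem (transient_matrix N) lam \<phi> \<psi>"
    and "\<And>z. \<sigma> (\<sigma> z) = z"
    and "\<And>z. \<kappa> z > 0"
    and "\<And>\<nu> z. \<nu> \<in> {1..CARD('t)} \<Longrightarrow>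
           spectral_coeff \<phi> \<psi> (flux N D1) \<nu> z
             = complex_of_real (\<kappa> z) * spectral_coeff \<phi> \<psi> (flux N D0) \<nu> (\<sigma> z)"
    and "\<And>z. \<kappa> z * \<kappa> (\<sigma> z) = K"
    and "\<And>\<nu>. \<nu> \<in> {1..CARD('t)} \<Longrightarrow> scalar_product (\<psi> \<nu>) (flux N D0) \<noteq> 0"
    and "\<gamma> \<in> {0<..<1}"
  shows "reflection \<sigma> ** resolvent (transient_matrix N) \<gamma> ** reflection \<sigma>
       = matrix_inv (weight_matrix \<kappa> ** weight_matrix \<kappa>)
           ** resolvent (transient_matrix N) \<gamma> ** (weight_matrix \<kappa> ** weight_matrix \<kappa>)"
proof -
  let ?R = "reflection \<sigma>" and ?D = "weight_matrix \<kappa> ** weight_matrix \<kappa>"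
  let ?P = "transient_matrix N" and ?G = "resolvent (transient_matrix N) \<gamma>"
  let ?A = "mat 1 - (1 - \<gamma>) *\<^sub>R ?P"
  define r where "r \<nu> = scalar_product (\<psi> \<nu>) (flux N D1) / scalar_product (\<psi> \<nu>) (flux N D0)" for \<nu>
  have eig: "(?D ** ?R) *v \<phi> \<nu> = r \<nu> *s \<phi> \<nu>" if \<nu>: "\<nu> \<in> {1..CARD('t)}" for \<nu>
  proof -
    have "complex_of_real (\<kappa> z) * \<phi> \<nu> $ \<sigma> z = r \<nu> * \<phi> \<nu> $ z" for z
      using assms(5)[OF \<nu>, of z] assms(7)[OF \<nu>]
      by (simp add: r_def spectral_coeff_def field_simps)
    then have "(?D *v (?R *v \<phi> \<nu>)) $ z = (r \<nu> *s \<phi> \<nu>) $ z" for z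
      by (simp add: weight_matrix_squared_apply[OF assms(4)] reflection_apply)
    then show ?thesis
      by (simp add: vec_eq_iff flip: matrix_vector_mul_assoc)
  qed
  have "(?D ** ?R) ** ?P = ?P ** (?D ** ?R)"
    using commute_if_common_eigensystem[OF assms(2) eig] .
  then have "(?D ** ?R) ** ?A = ?A ** (?D ** ?R)"
    by (rule commute_id_minus)
  then have comm: "(?D ** ?R) ** ?G = ?G ** (?D ** ?R)"
    unfolding resolvent_def
    by (rule matrix_inv_commute[OF invertible_id_minus_transient[OF assms(8)]])
  have "?R ** ?G ** ?R = matrix_inv ?D ** ?D ** ?R ** ?G ** ?R"
    by (simp add: matrix_inv_left[OF invertible_weight_matrix_squared[OF assms(4)]])
  also have "\<dots> = matrix_inv ?D ** ((?D ** ?R) ** ?G) ** ?R"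
    by (simp add: matrix_mul_assoc)
  also have "\<dots> = matrix_inv ?D ** ?G ** ?D ** (?R ** ?R)"
    unfolding comm by (simp add: matrix_mul_assoc)
  also have "\<dots> = matrix_inv ?D ** ?G ** ?D"
    by (simp add: reflection_involution[OF assms(3)])
  finally show ?thesis .
qed

end
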